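(* Let $\Delta\neq\mathbb{N}$ be a numerical semigroup and let $d\ge2$ be an integer. The following are equivalent for a numerical semigroup $S$: (1) $S/d=\Delta$ and $\operatorname{rank}_{\mathcal{M}_d(\Delta)}(S)=1$; (2) there exists $x\in\Delta\setminus d\Delta$ with $\gcd(x,d)=1$ such that $S=\langle x\rangle+d\Delta$. Moreover, in this case $x$ is uniquely determined by $S$ and equals $\min(S\setminus d\Delta)$.
   Context: $\mathbb{N}=\{0,1,2,\dots\}$. A numerical semigroup is a submonoid of $(\mathbb{N},+)$ with finite complement in $\mathbb{N}$. For $A\subseteq\mathbb{N}$, $A/d=\{x\in\mathbb{N}: dx\in A\}$ and $dA=\{dx:x\in A\}$; $A+B=\{a+b:a\in A,b\in B\}$; $\langle X\rangle$ is the submonoid of $(\mathbb{N},+)$ generated by $X$, and $\langle x\rangle=\langle\{x\}\rangle$. An $\mathcal{M}_d(\Delta)$-monoid is a submonoid $M$ of $(\mathbb{N},+)$ with $M/d=\Delta$. A subset $X\subseteq M$ is an $\mathcal{M}_d(\Delta)$-system of generators of $M$ if $M=\langle X\rangle+d\Delta$; it is minimal if no proper subset of $X$ has this property. Every $\mathcal{M}_d(\Delta)$-monoid $M$ has a unique minimal $\mathcal{M}_d(\Delta)$-system of generators (it equals the set of elements of the minimal system of generators of the monoid $M$ that are not in $d\Delta$), and $\operatorname{rank}_{\mathcal{M}_d(\Delta)}(M)$ is its cardinality. *)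

theory Defs
  imports Complex_Main "HOL-Library.Set_Algebras"
begin

text \<open>
  Sums and dilates of subsets of \<open>nat\<close> are those of \<open>HOL-Library.Set_Algebras\<close>:
  \<open>A + B\<close> is the elementwise sum and \<open>d *o A\<close> is the set of all \<open>d * a\<close> with \<open>a \<in> A\<close>.
\<close>

definition submonoid_nat :: "nat set \<Rightarrow> bool" where
  "submonoid_nat M \<longleftrightarrow> 0 \<in> M \<and> (\<forall>a\<in>M. \<forall>b\<in>M. a + b \<in> M)"

definition numerical_semigroup :: "nat set \<Rightarrow> bool" where
  "numerical_semigroup S \<longleftrightarrow> submonoid_nat S \<and> finite (- S)"

definition monoid_span :: "nat set \<Rightarrow> nat set" where
  "monoid_span X = submonoid_nat hull X"

definition set_quotient :: "nat set \<Rightarrow> nat \<Rightarrow> nat set" where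
  "set_quotient A d = {x. d * x \<in> A}"

definition Md_monoid :: "nat \<Rightarrow> nat set \<Rightarrow> nat set \<Rightarrow> bool" where
  "Md_monoid d \<Delta> M \<longleftrightarrow> submonoid_nat M \<and> set_quotient M d = \<Delta>"

definition Md_generators :: "nat \<Rightarrow> nat set \<Rightarrow> nat set \<Rightarrow> nat set \<Rightarrow> bool" where
  "Md_generators d \<Delta> M X \<longleftrightarrow> X \<subseteq> M \<and> M = monoid_span X + d *o \<Delta>"

definition Md_minimal_generators :: "nat \<Rightarrow> nat set \<Rightarrow> nat set \<Rightarrow> nat set \<Rightarrow> bool" where
  "Md_minimal_generators d \<Delta> M X \<longleftrightarrow>
     Md_generators d \<Delta> M X \<and> (\<forall>Y. Y \<subset> X \<longrightarrow> \<not> Md_generators d \<Delta> M Y)"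

text \<open>
  The rank is meaningful only for \<open>Md_monoid d \<Delta> M\<close>: then the minimal system of generators
  exists and is unique, so the definite description denotes it. It is also finite, so \<open>card\<close>
  is the true cardinality.
\<close>

definition Md_rank :: "nat \<Rightarrow> nat set \<Rightarrow> nat set \<Rightarrow> nat" where
  "Md_rank d \<Delta> M = card (THE X. Md_minimal_generators d \<Delta> M X)"

end

theory Submission imports Defs begin

text \<open>
  The elements of \<open>S\<close> outside \<open>d *o \<Delta>\<close> that are not a sum of two nonzero elements of \<open>S\<close> lie in
  every system of generators and, by descent, form one; so they are the least system of
  generators. Rank one thus means \<open>S = monoid_span {x} + d *o \<Delta>\<close> with \<open>x \<notin> d *o \<Delta>\<close>. Then
  \<open>gcd x d\<close> divides every element of the cofinite set \<open>S\<close>, hence is \<open>1\<close>; conversely, coprimality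
  makes \<open>d dvd k * x\<close> equivalent to \<open>d dvd k\<close>, which gives \<open>S/d = \<Delta>\<close>.
\<close>

text \<open>The atoms of \<open>M\<close> outside \<open>d *o \<Delta>\<close>. The splitting
  condition alone also admits \<open>0\<close>, which is excluded as soon as
  \<open>0 \<in> \<Delta>\<close>. This explicit set replaces the definite description in
  \<open>Md_rank\<close>.\<close>

definition Md_irreducibles :: "nat \<Rightarrow> nat set \<Rightarrow> nat set \<Rightarrow> nat set" where
  "Md_irreducibles d \<Delta> M =
     {x \<in> M - d *o \<Delta>. \<forall>a\<in>M. \<forall>b\<in>M. x = a + b \<longrightarrow> a = 0 \<or> b = 0}"

section \<open>Submonoids of the natural numbers and their spans\<close>

lemma submonoid_natD:
  assumes "submonoid_nat M"
  shows "0 \<in> M" and "a \<in> M \<Longrightarrow> b \<in> M \<Longrightarrow> a + b \<in> M"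
  using assms by (auto simp: submonoid_nat_def)

lemma submonoid_nat_mult:
  assumes "submonoid_nat M" and "a \<in> M"
  shows "k * a \<in> M"
  using assms by (induction k) (auto simp: submonoid_nat_def)

lemma submonoid_nat_set_plus:
  assumes "submonoid_nat A" and "submonoid_nat B"
  shows "submonoid_nat (A + B)"
  unfolding submonoid_nat_def
proof (intro conjI ballI)
  show "0 \<in> A + B"
    using set_plus_intro[of 0 A 0 B] assms by (simp add: submonoid_nat_def)
next
  fix u v assume "u \<in> A + B" "v \<in> A + B"
  then obtain a b a' b' where "a \<in> A" "b \<in> B" "a' \<in> A" "b' \<in> B" "u = a + b" "v = a' + b'"
    by (auto elim!: set_plus_elim)
  moreover from this have "(a + a') + (b + b') \<in> A + B"
    using assms by (intro set_plus_intro) (auto simp: submonoid_nat_def)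
  ultimately show "u + v \<in> A + B" by (simp add: ac_simps)
qed

lemma submonoid_nat_dilate:
  assumes "submonoid_nat A"
  shows "submonoid_nat (d *o A)"
  using assms by (auto simp: submonoid_nat_def elt_set_times_def simp flip: distrib_left)

lemma submonoid_nat_monoid_span: "submonoid_nat (monoid_span X)"
  unfolding monoid_span_def by (rule hull_in) (auto simp: submonoid_nat_def)

lemma subset_monoid_span: "X \<subseteq> monoid_span X"
  unfolding monoid_span_def by (rule hull_subset)

lemma monoid_span_minimal: "X \<subseteq> M \<Longrightarrow> submonoid_nat M \<Longrightarrow> monoid_span X \<subseteq> M"
  unfolding monoid_span_def by (rule hull_minimal)

lemma monoid_span_empty: "monoid_span {} = {0}"
proof
  show "monoid_span {} \<subseteq> {0}"
    by (rule monoid_span_minimal) (auto simp: submonoid_nat_def)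
  show "{0} \<subseteq> monoid_span {}"
    using submonoid_natD(1)[OF submonoid_nat_monoid_span] by simp
qed

lemma monoid_span_singleton: "monoid_span {x} = range (\<lambda>k. k * x)"
proof
  have "x \<in> range (\<lambda>k. k * x)"
    by (rule range_eqI[of _ _ 1]) simp
  moreover have "submonoid_nat (range (\<lambda>k. k * x))"
    unfolding submonoid_nat_def
  proof (intro conjI ballI)
    show "0 \<in> range (\<lambda>k. k * x)"
      by (rule range_eqI[of _ _ 0]) simp
    show "a + b \<in> range (\<lambda>k. k * x)"
      if "a \<in> range (\<lambda>k. k * x)" "b \<in> range (\<lambda>k. k * x)" for a b
      using that by (auto simp flip: distrib_right)
  qed
  ultimately show "monoid_span {x} \<subseteq> range (\<lambda>k. k * x)"
    by (intro monoid_span_minimal) auto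
  show "range (\<lambda>k. k * x) \<subseteq> monoid_span {x}"
    using submonoid_nat_mult[OF submonoid_nat_monoid_span] subset_monoid_span[of "{x}"] by auto
qed

lemma mem_monoid_span_singleton_plus_dilate:
  "s \<in> monoid_span {x} + d *o \<Delta> \<longleftrightarrow> (\<exists>k. \<exists>\<delta>\<in>\<Delta>. s = k * x + d * \<delta>)"
  by (auto simp: monoid_span_singleton set_plus_def elt_set_times_def)

lemma dilate_subset:
  assumes "set_quotient M d = \<Delta>"
  shows "d *o \<Delta> \<subseteq> M"
  using assms by (auto simp: set_quotient_def elt_set_times_def)

text \<open>Splits a span element once, without words or coefficients: the elements of the three
  shapes already form a submonoid containing \<open>Y\<close>, so minimality of the span
  applies.\<close>

lemma monoid_span_cases:
  assumes "y \<in> monoid_span Y"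
  obtains "y = 0" | "y \<in> Y"
    | a b where "a \<in> monoid_span Y" "b \<in> monoid_span Y" "a \<noteq> 0" "b \<noteq> 0" "y = a + b"
proof -
  let ?T = "{0} \<union> Y \<union> {a + b |a b. a \<in> monoid_span Y \<and> b \<in> monoid_span Y \<and> a \<noteq> 0 \<and> b \<noteq> 0}"
  have sub: "?T \<subseteq> monoid_span Y"
    using subset_monoid_span submonoid_natD[OF submonoid_nat_monoid_span] by auto
  have "submonoid_nat ?T"
    unfolding submonoid_nat_def
  proof (intro conjI ballI)
    fix a b assume ab: "a \<in> ?T" "b \<in> ?T"
    then have "a \<in> monoid_span Y" "b \<in> monoid_span Y" using sub by blast+
    then show "a + b \<in> ?T"
      \<comment> \<open>If one summand is \<open>0\<close>, the sum is the other one, already in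
        \<open>?T\<close>; otherwise the sum has the third shape.\<close>
      using ab by (cases "a = 0"; cases "b = 0") auto
  qed simp
  then have "monoid_span Y \<subseteq> ?T"
    by (intro monoid_span_minimal) auto
  with assms that show thesis by blast
qed

section \<open>Irreducible elements and the rank\<close>

lemma Md_irreducibles_subset_generators:
  assumes "submonoid_nat M" and "submonoid_nat \<Delta>" and "Md_generators d \<Delta> M Y"
  shows "Md_irreducibles d \<Delta> M \<subseteq> Y"
proof
  fix x assume "x \<in> Md_irreducibles d \<Delta> M"
  then have x: "x \<in> M" "x \<notin> d *o \<Delta>"
    and irr: "\<And>a b. a \<in> M \<Longrightarrow> b \<in> M \<Longrightarrow> x = a + b \<Longrightarrow> a = 0 \<or> b = 0"
    by (auto simp: Md_irreducibles_def)
  have M: "Y \<subseteq> M" "M = monoid_span Y + d *o \<Delta>"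
    using assms(3) by (auto simp: Md_generators_def)
  have span: "monoid_span Y \<subseteq> M"
    using M(1) assms(1) by (rule monoid_span_minimal)
  have 0: "0 \<in> d *o \<Delta>" "0 \<in> monoid_span Y"
    using submonoid_natD(1) submonoid_nat_dilate[OF assms(2)] submonoid_nat_monoid_span
    by blast+
  have dil: "d *o \<Delta> \<subseteq> M"
    using set_zero_plus2[OF 0(2)] M(2) by blast
  obtain y z where yz: "y \<in> monoid_span Y" "z \<in> d *o \<Delta>" "x = y + z"
    using x(1) M(2) by (auto elim: set_plus_elim)
  \<comment> \<open>Irreducibility kills one of the two parts of \<open>x\<close>. It cannot be
    \<open>y\<close>, since then \<open>x = z\<close> would lie in
    \<open>d *o \<Delta>\<close>.\<close>
  have "y = 0 \<or> z = 0"
    using irr yz span dil by blast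
  with yz x(2) have "z = 0" by auto
  then have "x \<in> monoid_span Y" using yz by simp
  then show "x \<in> Y"
  proof (cases rule: monoid_span_cases)
    case 1
    with x(2) 0(1) show ?thesis by simp
  next
    case (3 a b)
    with irr span show ?thesis by blast
  qed
qed

lemma Md_generators_irreducibles:
  assumes "submonoid_nat M" and "submonoid_nat \<Delta>" and "d *o \<Delta> \<subseteq> M"
  shows "Md_generators d \<Delta> M (Md_irreducibles d \<Delta> M)"
proof -
  let ?X = "Md_irreducibles d \<Delta> M"
  let ?N = "monoid_span ?X + d *o \<Delta>"
  have X: "?X \<subseteq> M" by (auto simp: Md_irreducibles_def)
  have N: "submonoid_nat ?N"
    by (intro submonoid_nat_set_plus submonoid_nat_monoid_span submonoid_nat_dilate assms)
  have 0: "0 \<in> d *o \<Delta>" "0 \<in> monoid_span ?X"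
    using submonoid_natD(1) submonoid_nat_dilate[OF assms(2)] submonoid_nat_monoid_span
    by blast+
  have "s \<in> ?N" if "s \<in> M" for s
    using that
  proof (induction s rule: less_induct)
    case (less s)
    consider "s \<in> d *o \<Delta>" | "s \<in> ?X"
      | a b where "a \<in> M" "b \<in> M" "s = a + b" "a \<noteq> 0" "b \<noteq> 0"
      using less.prems by (auto simp: Md_irreducibles_def)
    then show ?case
    proof cases
      case 1
      then show ?thesis using set_zero_plus2[OF 0(2)] by blast
    next
      case 2
      then have "s \<in> monoid_span ?X" using subset_monoid_span by blast
      then show ?thesis using set_plus_intro[OF _ 0(1), of s] by simp
    next
      case (3 a b)
      \<comment> \<open>Both summands are nonzero, hence smaller than \<open>s\<close>, and
        \<open>?N\<close> is closed under addition.\<close>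
      then show ?thesis using less.IH submonoid_natD(2)[OF N] by simp
    qed
  qed
  moreover have "?N \<subseteq> M"
    using monoid_span_minimal[OF X assms(1)] assms(3) submonoid_natD(2)[OF assms(1)]
    by (auto elim!: set_plus_elim)
  ultimately show ?thesis
    using X by (auto simp: Md_generators_def)
qed

text \<open>A generating set contained in every generating set is the only minimal one, so the
  definite description resolves to it.\<close>

lemma Md_rank_eq_card_irreducibles:
  assumes "submonoid_nat M" and "submonoid_nat \<Delta>" and "d *o \<Delta> \<subseteq> M"
  shows "Md_rank d \<Delta> M = card (Md_irreducibles d \<Delta> M)"
proof -
  have "(THE X. Md_minimal_generators d \<Delta> M X) = Md_irreducibles d \<Delta> M"
    using Md_generators_irreducibles[OF assms]
      Md_irreducibles_subset_generators[OF assms(1,2)]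
    by (intro the_equality) (unfold Md_minimal_generators_def, blast+)
  then show ?thesis by (simp add: Md_rank_def)
qed

section \<open>Monoids with one generator\<close>

lemma cofinite_dvd_imp_eq_one:
  fixes g :: nat
  assumes "finite (- S)" and "\<And>s. s \<in> S \<Longrightarrow> g dvd s"
  shows "g = 1"
proof -
  \<comment> \<open>With \<open>n\<close> above all gaps, two consecutive numbers lie in
    \<open>S\<close>, and \<open>g\<close> divides their difference \<open>1\<close>.\<close>
  obtain n where "- S \<subseteq> {..<n}"
    using assms(1) by (metis finite_nat_set_iff_bounded lessThan_iff subsetI)
  then have "n \<in> S" "Suc n \<in> S" by auto
  then have "g dvd Suc n - n"
    using assms(2) by (intro dvd_diff_nat) auto
  then show ?thesis by simp
qed

lemma rank_one_imp_generated:
  assumes "numerical_semigroup \<Delta>" and "numerical_semigroup S"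
    and "set_quotient S d = \<Delta>" and "Md_rank d \<Delta> S = 1"
  obtains x where "x \<in> \<Delta> - d *o \<Delta>" "gcd x d = 1" "S = monoid_span {x} + d *o \<Delta>"
proof -
  have sub: "submonoid_nat S" "submonoid_nat \<Delta>" and fin: "finite (- S)"
    using assms(1,2) by (auto simp: numerical_semigroup_def)
  note dil = dilate_subset[OF assms(3)]
  obtain x where X: "Md_irreducibles d \<Delta> S = {x}"
    using assms(4) Md_rank_eq_card_irreducibles[OF sub dil] by (auto simp: card_1_singleton_iff)
  then have x: "x \<in> S" "x \<notin> d *o \<Delta>" by (auto simp: Md_irreducibles_def)
  have S: "S = monoid_span {x} + d *o \<Delta>"
    using Md_generators_irreducibles[OF sub dil] X by (simp add: Md_generators_def)
  have "d * x \<in> S" using sub(1) x(1) by (rule submonoid_nat_mult)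
  then have "x \<in> \<Delta>" using assms(3) by (auto simp: set_quotient_def)
  moreover have "gcd x d dvd s" if "s \<in> S" for s
    using that unfolding S mem_monoid_span_singleton_plus_dilate by auto
  then have "gcd x d = 1" using fin by (intro cofinite_dvd_imp_eq_one) auto
  ultimately show thesis using x(2) S by (intro that DiffI)
qed

lemma generated_imp_quotient:
  assumes "submonoid_nat \<Delta>" and "d > 0" and "x \<in> \<Delta>" and "gcd x d = 1"
    and "S = monoid_span {x} + d *o \<Delta>"
  shows "set_quotient S d = \<Delta>"
proof (intro set_eqI iffI)
  fix s assume "s \<in> set_quotient S d"
  then obtain k \<delta> where k: "\<delta> \<in> \<Delta>" "d * s = k * x + d * \<delta>"
    by (auto simp: set_quotient_def assms(5) mem_monoid_span_singleton_plus_dilate)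
  then have "d dvd k * x" by (metis dvd_add_left_iff dvd_triv_left)
  moreover have "coprime d x" using assms(4) by (simp add: coprime_iff_gcd_eq_1 gcd.commute)
  \<comment> \<open>Since \<open>d\<close> divides \<open>k\<close>, the whole equation can be
    divided by \<open>d\<close>; what remains is a sum in \<open>\<Delta>\<close> because
    \<open>x \<in> \<Delta>\<close>.\<close>
  ultimately obtain j where "k = d * j" by (auto simp: coprime_dvd_mult_left_iff)
  with k(2) have "d * s = d * (j * x + \<delta>)" by (simp add: algebra_simps)
  then have "s = j * x + \<delta>" using assms(2) by simp
  then show "s \<in> \<Delta>"
    using submonoid_nat_mult submonoid_natD(2) assms(1,3) k(1) by simp
next
  fix s assume "s \<in> \<Delta>"
  \<comment> \<open>Coefficient \<open>0\<close> of \<open>x\<close> suffices: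
    \<open>d * s = 0 * x + d * s\<close>.\<close>
  then show "s \<in> set_quotient S d"
    unfolding set_quotient_def assms(5) mem_Collect_eq mem_monoid_span_singleton_plus_dilate
    by (intro exI[of _ 0] bexI[of _ s]) auto
qed

lemma generator_mem:
  assumes "submonoid_nat \<Delta>"
  shows "x \<in> monoid_span {x} + d *o \<Delta>"
  using set_plus_intro[of x "monoid_span {x}" 0 "d *o \<Delta>"] subset_monoid_span[of "{x}"]
    submonoid_natD(1)[OF submonoid_nat_dilate[OF assms]] by simp

text \<open>The generating set \<open>{x}\<close> leaves room for at most one irreducible. With
  none, \<open>S\<close> would collapse to \<open>d *o \<Delta>\<close>, which misses
  \<open>x\<close>.\<close>

lemma generated_imp_rank_one:
  assumes "submonoid_nat S" and "submonoid_nat \<Delta>" and "set_quotient S d = \<Delta>"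
    and "x \<notin> d *o \<Delta>" and "S = monoid_span {x} + d *o \<Delta>"
  shows "Md_rank d \<Delta> S = 1"
proof -
  note dil = dilate_subset[OF assms(3)]
  have x: "x \<in> S" using generator_mem[OF assms(2)] assms(5) by simp
  then have "Md_generators d \<Delta> S {x}"
    using assms(5) by (simp add: Md_generators_def)
  then have "Md_irreducibles d \<Delta> S \<subseteq> {x}"
    by (rule Md_irreducibles_subset_generators[OF assms(1,2)])
  moreover have "Md_irreducibles d \<Delta> S \<noteq> {}"
  proof
    assume "Md_irreducibles d \<Delta> S = {}"
    then have "S = {0} + d *o \<Delta>"
      using Md_generators_irreducibles[OF assms(1,2) dil]
      by (simp add: Md_generators_def monoid_span_empty)
    then show False using x assms(4) by (auto elim!: set_plus_elim)
  qed
  ultimately have "Md_irreducibles d \<Delta> S = {x}" by blast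
  then show ?thesis using Md_rank_eq_card_irreducibles[OF assms(1,2) dil] by simp
qed

text \<open>An element outside \<open>d *o \<Delta>\<close> must use \<open>x\<close> with a nonzero
  coefficient, so it is at least \<open>x\<close>. As the right-hand side depends only on
  \<open>S\<close>, \<open>d\<close> and \<open>\<Delta>\<close>, this also yields uniqueness of the
  generator.\<close>

lemma generator_eq_Least:
  assumes "submonoid_nat \<Delta>" and "x \<notin> d *o \<Delta>" and "S = monoid_span {x} + d *o \<Delta>"
  shows "x = (LEAST y. y \<in> S - d *o \<Delta>)"
proof (rule sym, rule Least_equality)
  show "x \<in> S - d *o \<Delta>" using generator_mem[OF assms(1)] assms(2,3) by simp
next
  fix y assume y: "y \<in> S - d *o \<Delta>"
  then obtain k \<delta> where k: "\<delta> \<in> \<Delta>" "y = k * x + d * \<delta>"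
    by (auto simp: assms(3) mem_monoid_span_singleton_plus_dilate)
  with y have "k \<noteq> 0" by (auto simp: elt_set_times_def)
  with k(2) show "x \<le> y" by (cases k) auto
qed

theorem theorem4p12:
  fixes \<Delta> S :: "nat set" and d :: nat
  assumes "numerical_semigroup \<Delta>" and "\<Delta> \<noteq> UNIV" and "d \<ge> 2"
    and "numerical_semigroup S"
  shows "((set_quotient S d = \<Delta> \<and> Md_rank d \<Delta> S = 1) \<longleftrightarrow>
          (\<exists>x \<in> \<Delta> - d *o \<Delta>. gcd x d = 1 \<and> S = monoid_span {x} + d *o \<Delta>))
       \<and> ((set_quotient S d = \<Delta> \<and> Md_rank d \<Delta> S = 1) \<longrightarrow>
          (\<exists>!x. x \<in> \<Delta> - d *o \<Delta> \<and> gcd x d = 1 \<and> S = monoid_span {x} + d *o \<Delta>)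
          \<and> S - d *o \<Delta> \<noteq> {}
          \<and> (\<forall>x \<in> \<Delta> - d *o \<Delta>. gcd x d = 1 \<and> S = monoid_span {x} + d *o \<Delta>
               \<longrightarrow> x = (LEAST y. y \<in> S - d *o \<Delta>)))"
proof -
  have sub: "submonoid_nat S" "submonoid_nat \<Delta>"
    using assms(1,4) by (auto simp: numerical_semigroup_def)
  have d: "d > 0" using assms(3) by simp
  \<comment> \<open>Naming the two conditions makes the final combination purely
    first-order.\<close>
  define gen where "gen x \<longleftrightarrow> x \<in> \<Delta> - d *o \<Delta> \<and> gcd x d = 1 \<and> S = monoid_span {x} + d *o \<Delta>" for x
  have genD: "x \<in> \<Delta>" "x \<notin> d *o \<Delta>" "gcd x d = 1" "S = monoid_span {x} + d *o \<Delta>"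
    if "gen x" for x
    using that by (simp_all only: gen_def Diff_iff not_False_eq_True simp_thms)
  define rank1 where "rank1 \<longleftrightarrow> set_quotient S d = \<Delta> \<and> Md_rank d \<Delta> S = 1"
  have one: rank1 if "gen x" for x
    using generated_imp_quotient[OF sub(2) d genD(1,3,4)[OF that]]
      generated_imp_rank_one[OF sub _ genD(2,4)[OF that]]
    by (simp add: rank1_def)
  have two: "\<exists>x. gen x" if rank1
    using rank_one_imp_generated[OF assms(1,4)] that unfolding rank1_def gen_def by metis
  have least: "x = (LEAST y. y \<in> S - d *o \<Delta>)" if "gen x" for x
    using genD(2,4)[OF that] by (rule generator_eq_Least[OF sub(2)])
  have nonempty: "S - d *o \<Delta> \<noteq> {}" if "gen x" for x
    using generator_mem[OF sub(2), of x d] genD(2,4)[OF that] by blast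
  \<comment> \<open>Any two generators equal the same least element.\<close>
  have "\<exists>!x. gen x" if rank1
    using two[OF that] least by metis
  then have "(rank1 \<longleftrightarrow> (\<exists>x. gen x)) \<and>
      (rank1 \<longrightarrow> (\<exists>!x. gen x) \<and> S - d *o \<Delta> \<noteq> {} \<and>
        (\<forall>x. gen x \<longrightarrow> x = (LEAST y. y \<in> S - d *o \<Delta>)))"
    using one two least nonempty by metis
  then show ?thesis
    unfolding rank1_def gen_def Bex_def Ball_def imp_conjL .
qed

end
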